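(* Assume: (A) $\Omega_\alpha$ is compact, convex and connected, $\Omega_\gamma$ is compact, and $g$ is continuously differentiable in $\alpha$ with $D_\alpha g$ jointly continuous on $\Omega_\alpha\times\Omega_\gamma$; (B) for all $\alpha_1,\alpha_2\in\Omega_\alpha$, if $g(\alpha_1,\gamma)=g(\alpha_2,\gamma)$ for all $\gamma\in\Omega_\gamma$, then $\alpha_1=\alpha_2$; (C) there exist $p_\alpha<\infty$ with $d_\alpha\le d_Gp_\alpha$ and points $\gamma_{0,1},\dots,\gamma_{0,p_\alpha}\in\Omega_\gamma$ such that for every $\alpha\in\Omega_\alpha$ the stacked Jacobian $[D_\alpha g(\alpha,\gamma_{0,1});\dots;D_\alpha g(\alpha,\gamma_{0,p_\alpha})]\in\mathbb{R}^{d_Gp_\alpha\times d_\alpha}$ has full column rank $d_\alpha$. Then there exists a finite $R_0$ such that for every $R\ge R_0$ the leading truncation $U_R$ is injective on $\Omega_\alpha$.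
   Context: $\Omega_\alpha\subseteq\mathbb{R}^{d_\alpha}$ and $\Omega_\gamma\subseteq\mathbb{R}^{d_\gamma}$ are the supports of probability measures $\pi_\alpha$ and $\pi_\gamma$ having Lebesgue densities bounded away from $0$ and $\infty$ on $\Omega_\alpha$, $\Omega_\gamma$. The kernel $g:\Omega_\alpha\times\Omega_\gamma\to\mathbb{R}^{d_G}$ is measurable with $\int\int\lVert g\rVert^2d\pi_\gamma d\pi_\alpha<\infty$. $T_g:L^2(\pi_\gamma)\to L^2(\pi_\alpha;\mathbb{R}^{d_G})$ is the Hilbert-Schmidt operator $(T_g\phi)(\alpha)=\int g(\alpha,\gamma)\phi(\gamma)d\pi_\gamma(\gamma)$. Fix a singular system: positive singular values $\sigma_1\ge\sigma_2\ge\cdots>0$ (with multiplicity), orthonormal $\mathbb{R}^{d_G}$-valued $u_r\in L^2(\pi_\alpha;\mathbb{R}^{d_G})$ and orthonormal scalar $v_r\in L^2(\pi_\gamma)$ with $g(\alpha,\gamma)=\sum_r\sigma_ru_r(\alpha)v_r(\gamma)$ in $L^2(\pi_\alpha\otimes\pi_\gamma;\mathbb{R}^{d_G})$. Pointwise, $u_r$ denotes the version $u_r=\sigma_r^{-1}T_gv_r$ (which is $C^1$ under (A)). The leading truncation of order $R$ is $U_R(\alpha)=(u_1(\alpha)^\top,\dots,u_R(\alpha)^\top)^\top\in\mathbb{R}^{d_GR}$; if $T_g$ has finite rank $M$, then $U_R:=U_M$ for $R\ge M$. Derivatives at boundary points of $\Omega_\alpha$ (which has nonempty interior, by the density bounds)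 are the continuous extensions of the derivatives from the interior. *)

theory Defs
  imports "HOL-Probability.Probability"
begin

definition measure_support :: "'x::topological_space measure \<Rightarrow> 'x set" where
  "measure_support P = {x. \<forall>U. open U \<longrightarrow> x \<in> U \<longrightarrow> 0 < emeasure P U}"

text \<open>
  The measure lives on the whole Euclidean space; the bounds on its density are only required on
  \<open>\<Omega>\<close>. When \<open>\<Omega>\<close> is the support, the density vanishes almost everywhere outside of it.
\<close>

definition has_bounded_density_on :: "'x::euclidean_space measure \<Rightarrow> 'x set \<Rightarrow> bool" where
  "has_bounded_density_on P \<Omega> \<longleftrightarrow>
     (\<exists>f \<in> borel_measurable borel. \<exists>l b :: real.
        P = density lborel (\<lambda>x. ennreal (f x)) \<and> (\<forall>x. 0 \<le> f x) \<and>
        0 < l \<and> (\<forall>x\<in>\<Omega>. l \<le> f x \<and> f x \<le> b))"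

definition in_L2 :: "'x measure \<Rightarrow> 'x set \<Rightarrow> ('x \<Rightarrow> 'b::euclidean_space) \<Rightarrow> bool" where
  "in_L2 P \<Omega> f \<longleftrightarrow>
     set_borel_measurable P \<Omega> f \<and>
     (\<integral>\<^sup>+x\<in>\<Omega>. ennreal ((norm (f x))\<^sup>2) \<partial>P) < \<infinity>"

definition orthonormal_L2 ::
  "'x measure \<Rightarrow> 'x set \<Rightarrow> nat set \<Rightarrow> (nat \<Rightarrow> 'x \<Rightarrow> 'b::euclidean_space) \<Rightarrow> bool" where
  "orthonormal_L2 P \<Omega> I w \<longleftrightarrow>
     (\<forall>r\<in>I. in_L2 P \<Omega> (w r)) \<and>
     (\<forall>r\<in>I. \<forall>s\<in>I. (LINT x:\<Omega>|P. w r x \<bullet> w s x) = (if r = s then 1 else 0))"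

definition kernel_op ::
  "'y measure \<Rightarrow> 'y set \<Rightarrow> ('x \<Rightarrow> 'y \<Rightarrow> 'b::euclidean_space) \<Rightarrow> ('y \<Rightarrow> real) \<Rightarrow> 'x \<Rightarrow> 'b" where
  "kernel_op P \<Omega> g \<phi> \<alpha> = (LINT \<gamma>:\<Omega>|P. \<phi> \<gamma> *\<^sub>R g \<alpha> \<gamma>)"

text \<open>
  Singular triples are numbered from 1; \<open>M = \<infinity>\<close> means that the kernel operator has infinite rank,
  and \<open>M = enat m\<close> that it has finite rank \<open>m\<close>. The families \<open>\<sigma>\<close>, \<open>u\<close>, \<open>v\<close> are unconstrained
  outside of this index set.
\<close>

definition sv_index :: "enat \<Rightarrow> nat set" where
  "sv_index M = {r. 1 \<le> r \<and> enat r \<le> M}"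

definition singular_system ::
  "'x measure \<Rightarrow> 'x set \<Rightarrow> 'y measure \<Rightarrow> 'y set \<Rightarrow> ('x \<Rightarrow> 'y \<Rightarrow> 'b::euclidean_space) \<Rightarrow>
   enat \<Rightarrow> (nat \<Rightarrow> real) \<Rightarrow> (nat \<Rightarrow> 'x \<Rightarrow> 'b) \<Rightarrow> (nat \<Rightarrow> 'y \<Rightarrow> real) \<Rightarrow> bool" where
  "singular_system P A Q C g M \<sigma> u v \<longleftrightarrow>
     (\<forall>r\<in>sv_index M. 0 < \<sigma> r) \<and>
     antimono_on (sv_index M) \<sigma> \<and>
     orthonormal_L2 P A (sv_index M) u \<and>
     orthonormal_L2 Q C (sv_index M) v \<and>
     (\<lambda>N. \<integral>\<^sup>+z\<in>A \<times> C. (case z of (\<alpha>, \<gamma>) \<Rightarrow>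
        ennreal ((norm (g \<alpha> \<gamma> - (\<Sum>r\<in>sv_index M \<inter> {..N}. (\<sigma> r * v r \<gamma>) *\<^sub>R u r \<alpha>)))\<^sup>2))
        \<partial>(P \<Otimes>\<^sub>M Q)) \<longlonglongrightarrow> 0"

text \<open>
  An element of \<open>\<real>\<^bsup>d\<^sub>G R\<^esup>\<close> is given as the list of its \<open>R\<close> blocks in \<open>\<real>\<^bsup>d\<^sub>G\<^esup>\<close>.
  For finite rank \<open>M\<close> and \<open>R \<ge> M\<close> the list ends with \<open>u\<^sub>M\<close>.
\<close>

definition leading_truncation :: "enat \<Rightarrow> (nat \<Rightarrow> 'x \<Rightarrow> 'b) \<Rightarrow> nat \<Rightarrow> 'x \<Rightarrow> 'b list" where
  "leading_truncation M u R \<alpha> = [u r \<alpha>. r \<leftarrow> [1..<Suc R], enat r \<le> M]"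

text \<open>
  \<open>D \<alpha> \<gamma>\<close> is the Jacobian matrix of \<open>g\<close> in its first argument. At boundary points of \<open>A\<close> it is the
  continuous extension from the interior: if \<open>A\<close> is the closure of its interior,
  the conditions determine \<open>D\<close> uniquely on \<open>A \<times> C\<close>.
\<close>

definition has_continuous_jacobian_on ::
  "(real^'a) set \<Rightarrow> 'y::topological_space set \<Rightarrow> (real^'a \<Rightarrow> 'y \<Rightarrow> real^'g) \<Rightarrow>
   (real^'a \<Rightarrow> 'y \<Rightarrow> real^'a^'g) \<Rightarrow> bool" where
  "has_continuous_jacobian_on A C g D \<longleftrightarrow>
     (\<forall>\<gamma>\<in>C. continuous_on A (\<lambda>\<alpha>. g \<alpha> \<gamma>)) \<and>
     (\<forall>\<gamma>\<in>C. \<forall>\<alpha>\<in>interior A. ((\<lambda>a. g a \<gamma>) has_derivative (\<lambda>h. D \<alpha> \<gamma> *v h)) (at \<alpha>)) \<and>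
     continuous_on (A \<times> C) (\<lambda>(\<alpha>, \<gamma>). D \<alpha> \<gamma>)"

definition stacked_jacobian ::
  "(real^'a \<Rightarrow> 'y \<Rightarrow> real^'a^'g) \<Rightarrow> ('p::finite \<Rightarrow> 'y) \<Rightarrow> real^'a \<Rightarrow> real^'a^('p \<times> 'g)" where
  "stacked_jacobian D \<gamma>0 \<alpha> = (\<chi> pk. D \<alpha> (\<gamma>0 (fst pk)) $ snd pk)"

end

theory Submission
  imports Defs
begin

text \<open>
  If the claim fails, there are points \<open>a\<^sub>n \<noteq> b\<^sub>n\<close> at which \<open>u\<^sub>1, \<dots>, u\<^sub>n\<close> agree. The difference quotients
  \<open>(g(a\<^sub>n, \<cdot>) - g(b\<^sub>n, \<cdot>)) / \<bar>a\<^sub>n - b\<^sub>n\<bar>\<close> are uniformly bounded and orthogonal to \<open>v\<^sub>1, \<dots>, v\<^sub>n\<close>;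
  along a subsequence they converge pointwise to a continuous \<open>q\<close>, which is again a difference
  quotient of \<open>g\<close> or a directional derivative \<open>D\<^sub>\<alpha>g(a, \<cdot>)e\<close> with \<open>\<bar>e\<bar> = 1\<close>. The limit is orthogonal to all
  \<open>v\<^sub>r\<close>. Any bounded \<open>\<phi>\<close> orthogonal to all \<open>v\<^sub>r\<close> satisfies \<open>T\<^sub>g\<phi> = 0\<close> almost everywhere by the singular
  expansion, and everywhere because \<open>T\<^sub>g\<phi>\<close> is Lipschitz on the support. Hence each component \<open>\<phi>\<close> of \<open>q\<close>
  is orthogonal to the difference quotients, so to \<open>q\<close>, and vanishes. This contradicts (B) or (C).
  The limit \<open>q\<close> is continuous although \<open>g\<close> itself may be discontinuous in \<open>\<gamma>\<close>: the joint continuity of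
  \<open>D\<^sub>\<alpha>g\<close> controls the increments of \<open>g\<close> in \<open>\<alpha>\<close>.
\<close>

section \<open>Mean value inequality on convex sets, up to the boundary\<close>

lemma norm_matrix_vector_mult_le:
  fixes A :: "real^'n^'m"
  shows "norm (A *v x) \<le> norm A * norm x"
proof -
  have "norm (A *v x) \<le> L2_set (\<lambda>i. norm (A $ i) * norm x) UNIV"
    unfolding norm_vec_def[of "A *v x"]
    by (intro L2_set_mono) (auto simp: matrix_vector_mul_component Cauchy_Schwarz_ineq2)
  also have "\<dots> = norm A * norm x"
    by (simp add: norm_vec_def[of A] L2_set_left_distrib)
  finally show ?thesis .
qed

text \<open>Derivatives are available only in the interior, while \<open>x\<close> and
  \<open>y\<close> may lie on the boundary. Shrinking both towards an interior point
  \<open>z\<close> moves them into the interior, which is again convex, so the usual mean value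
  inequality applies there. By continuity it survives the limit in which the shrinking parameter
  \<open>t\<close> tends to 0.\<close>

lemma convex_interior_differentiable_bound:
  fixes f :: "'a::euclidean_space \<Rightarrow> 'b::real_normed_vector"
  assumes S: "convex S" "interior S \<noteq> {}" and cont: "continuous_on S f"
    and deriv: "\<And>x. x \<in> interior S \<Longrightarrow> (f has_derivative f' x) (at x)"
    and bound: "\<And>x h. x \<in> interior S \<Longrightarrow> norm (f' x h) \<le> B * norm h"
    and xy: "x \<in> S" "y \<in> S"
  shows "norm (f x - f y) \<le> B * norm (x - y)"
proof -
  obtain z where z: "z \<in> interior S" using S by blast
  define p where "p w t = w - t *\<^sub>R (w - z)" for w t
  have p_int: "p w t \<in> interior S" if "w \<in> S" "0 < t" "t \<le> 1" for w t
    unfolding p_def using mem_interior_convex_shrink[OF S(1) z that] .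
  have p_lim: "(p w \<longlongrightarrow> w) (at_right 0)" for w
    unfolding p_def by (rule tendsto_eq_intros refl | simp)+
  have ev: "eventually (\<lambda>t. 0 < t \<and> t \<le> (1::real)) (at_right 0)"
    unfolding eventually_at_right_field by (intro exI[of _ 1]) auto
  have f_lim: "((\<lambda>t. f (p w t)) \<longlongrightarrow> f w) (at_right 0)" if "w \<in> S" for w
  proof (rule continuous_on_tendsto_compose[OF cont p_lim that])
    show "eventually (\<lambda>t. p w t \<in> S) (at_right 0)"
      using ev by eventually_elim (use p_int[OF that] interior_subset in blast)
  qed
  have le: "norm (f (p x t) - f (p y t)) \<le> B * norm (p x t - p y t)" if "0 < t" "t \<le> 1" for t
    by (rule differentiable_bound[OF convex_interior[OF S(1)], where f' = f'])
      (use p_int xy that in \<open>auto intro!: has_derivative_at_withinI[OF deriv] onorm_le bound\<close>)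
  show ?thesis
  proof (rule tendsto_le[OF _ _ _ eventually_mono[OF ev]])
    show "((\<lambda>t. norm (f (p x t) - f (p y t))) \<longlongrightarrow> norm (f x - f y)) (at_right 0)"
      by (intro tendsto_intros f_lim xy)
    show "((\<lambda>t. B * norm (p x t - p y t)) \<longlongrightarrow> B * norm (x - y)) (at_right 0)"
      by (intro tendsto_intros p_lim)
  qed (use le in auto)
qed

section \<open>Supports of Borel measures\<close>

text \<open>The complement of the support is the union of all open null sets. By Lindelof's theorem
  countably many of them have the same union, which is therefore null.\<close>

lemma AE_in_measure_support:
  fixes P :: "'x::second_countable_topology measure"
  assumes [measurable_cong]: "sets P = sets borel"
  shows "AE x in P. x \<in> measure_support P"
proof -
  define \<F> where "\<F> = {U. open U \<and> emeasure P U = 0}"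
  obtain \<F>' where F': "\<F>' \<subseteq> \<F>" "countable \<F>'" "\<Union>\<F>' = \<Union>\<F>"
    using Lindelof[of \<F>] by (auto simp: \<F>_def)
  have "- measure_support P = \<Union>\<F>"
    by (auto simp: measure_support_def \<F>_def zero_less_iff_neq_zero)
  moreover have "(\<Union>U\<in>\<F>'. U) \<in> null_sets P"
    using F' assms by (intro null_sets_UN') (auto simp: \<F>_def intro!: null_setsI)
  ultimately have "- measure_support P \<in> null_sets P"
    using F' by simp
  from AE_not_in[OF this] show ?thesis
    by eventually_elim simp
qed

text \<open>The points of the support where \<open>f\<close> is nonzero are the trace of an open set
  \<open>U\<close>. This \<open>U\<close> is null, because almost every point lies in the support
  and is a zero of \<open>f\<close>; but an open set containing a point of the support has positive
  measure.\<close>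

lemma AE_eq_0_imp_eq_0_on_support:
  fixes f :: "'x::topological_space \<Rightarrow> 'b::real_normed_vector"
  assumes [measurable_cong]: "sets P = sets borel"
    and AE_in: "AE x in P. x \<in> measure_support P"
    and AE_0: "AE x in P. x \<in> measure_support P \<longrightarrow> f x = 0"
    and cont: "continuous_on (measure_support P) f" and x: "x \<in> measure_support P"
  shows "f x = 0"
proof (rule ccontr)
  assume "f x \<noteq> 0"
  moreover obtain U where U: "open U"
    "U \<inter> measure_support P = f -` (- {0}) \<inter> measure_support P"
    using cont open_Compl[OF closed_singleton[of "0::'b"]]
    unfolding continuous_on_open_invariant by metis
  ultimately have "x \<in> U" using x by blast
  then have "0 < emeasure P U" using x U(1) by (auto simp: measure_support_def)
  moreover have "AE x in P. x \<notin> U"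
    using AE_in AE_0 by eventually_elim (use U(2) in blast)
  then have "emeasure P U = 0"
    using U(1) assms(1) by (subst (asm) AE_iff_measurable[of U]) (auto dest: sets_eq_imp_space_eq)
  ultimately show False by simp
qed

section \<open>Functions orthogonal to the right singular functions\<close>

text \<open>Orthogonality removes the partial sum \<open>S N\<close> from the integral, so
  \<open>T x\<close> is also the integral of \<open>\<phi>\<close> against the remainder of the
  expansion. Cauchy-Schwarz in \<open>y\<close> followed by Tonelli bounds the squared L2 norm of
  \<open>T\<close> by \<open>K * E N\<close>, which tends to 0.\<close>

lemma AE_integral_eq_0_if_orthogonal:
  fixes G :: "'x \<Rightarrow> 'y \<Rightarrow> 'b::euclidean_space" and v :: "nat \<Rightarrow> 'y \<Rightarrow> real"
  assumes Q: "sigma_finite_measure Q"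
    and G [measurable]: "(\<lambda>(x, y). G x y) \<in> borel_measurable (P \<Otimes>\<^sub>M Q)"
    and u: "\<And>r. r \<in> I \<Longrightarrow> u r \<in> borel_measurable P"
    and v: "\<And>r. r \<in> I \<Longrightarrow> v r \<in> borel_measurable Q"
    and \<phi> [measurable]: "\<phi> \<in> borel_measurable Q"
    and \<phi>_L2: "(\<integral>\<^sup>+y. ennreal ((\<phi> y)\<^sup>2) \<partial>Q) < \<infinity>"
    and int_v: "\<And>r. r \<in> I \<Longrightarrow> integrable Q (\<lambda>y. \<phi> y * v r y)"
    and orth: "\<And>r. r \<in> I \<Longrightarrow> (\<integral>y. \<phi> y * v r y \<partial>Q) = 0"
    and int_G: "AE x in P. integrable Q (\<lambda>y. \<phi> y *\<^sub>R G x y)"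
    and lim: "(\<lambda>N. \<integral>\<^sup>+z. (case z of (x, y) \<Rightarrow> ennreal ((norm (G x y -
        (\<Sum>r\<in>I \<inter> {..N}. (\<sigma> r * v r y) *\<^sub>R u r x)))\<^sup>2)) \<partial>(P \<Otimes>\<^sub>M Q)) \<longlonglongrightarrow> 0"
  shows "AE x in P. (\<integral>y. \<phi> y *\<^sub>R G x y \<partial>Q) = 0"
proof -
  interpret Q: sigma_finite_measure Q by fact
  define S where "S N x y = (\<Sum>r\<in>I \<inter> {..N}. (\<sigma> r * v r y) *\<^sub>R u r x)" for N x y
  define T where "T x = (\<integral>y. \<phi> y *\<^sub>R G x y \<partial>Q)" for x
  define K where "K = (\<integral>\<^sup>+y. ennreal ((\<phi> y)\<^sup>2) \<partial>Q)"
  define E where "E N = (\<integral>\<^sup>+z. (case z of (x, y) \<Rightarrow> ennreal ((norm (G x y - S N x y))\<^sup>2)) \<partial>(P \<Otimes>\<^sub>M Q))" for N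
  have [measurable]: "T \<in> borel_measurable P"
    unfolding T_def by measurable
  have u_snd [measurable]: "(\<lambda>z. u r (fst z)) \<in> borel_measurable (P \<Otimes>\<^sub>M Q)"
    "(\<lambda>z. v r (snd z)) \<in> borel_measurable (P \<Otimes>\<^sub>M Q)" if "r \<in> I" for r
    using u[OF that] v[OF that] by measurable
  have S_meas [measurable]: "(\<lambda>(x, y). S N x y) \<in> borel_measurable (P \<Otimes>\<^sub>M Q)" for N
    unfolding S_def case_prod_beta
    by (intro borel_measurable_sum borel_measurable_scaleR borel_measurable_times u_snd) auto
  have err_meas: "(\<lambda>(x, y). ennreal ((norm (G x y - S N x y))\<^sup>2)) \<in> borel_measurable (P \<Otimes>\<^sub>M Q)" for N
    using G S_meas[of N] unfolding case_prod_beta by measurable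
  have S_int: "integrable Q (\<lambda>y. \<phi> y *\<^sub>R S N x y)" "(\<integral>y. \<phi> y *\<^sub>R S N x y \<partial>Q) = 0" for N x
  proof -
    have eq: "\<phi> y *\<^sub>R S N x y = (\<Sum>r\<in>I \<inter> {..N}. (\<phi> y * v r y) *\<^sub>R (\<sigma> r *\<^sub>R u r x))" for y
      by (simp add: S_def scaleR_sum_right mult_ac)
    show "integrable Q (\<lambda>y. \<phi> y *\<^sub>R S N x y)"
      unfolding eq by (intro Bochner_Integration.integrable_sum integrable_scaleR_left int_v) auto
    show "(\<integral>y. \<phi> y *\<^sub>R S N x y \<partial>Q) = 0"
      unfolding eq
      by (subst Bochner_Integration.integral_sum)
        (auto intro!: int_v sum.neutral simp: orth int_v simp del: scaleR_scaleR)
  qed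
  have T_le: "ennreal ((norm (T x))\<^sup>2) \<le> K * (\<integral>\<^sup>+y. ennreal ((norm (G x y - S N x y))\<^sup>2) \<partial>Q)"
    if int: "integrable Q (\<lambda>y. \<phi> y *\<^sub>R G x y)" and [simp]: "x \<in> space P" for x N
  proof -
    have [measurable]: "(\<lambda>y. G x y) \<in> borel_measurable Q" "(\<lambda>y. S N x y) \<in> borel_measurable Q"
      using measurable_Pair2[OF G] measurable_Pair2[OF S_meas] by simp_all
    have eq: "\<phi> y *\<^sub>R (G x y - S N x y) = \<phi> y *\<^sub>R G x y - \<phi> y *\<^sub>R S N x y" for y
      by (simp add: scaleR_diff_right)
    have "T x = (\<integral>y. \<phi> y *\<^sub>R (G x y - S N x y) \<partial>Q)"
      unfolding eq T_def using int S_int by simp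
    moreover have "integrable Q (\<lambda>y. \<phi> y *\<^sub>R (G x y - S N x y))"
      unfolding eq using int S_int by simp
    ultimately have "ennreal (norm (T x)) \<le> (\<integral>\<^sup>+y. ennreal (norm (\<phi> y *\<^sub>R (G x y - S N x y))) \<partial>Q)"
      using integral_norm_bound_ennreal by metis
    also have "\<dots> = (\<integral>\<^sup>+y. ennreal \<bar>\<phi> y\<bar> * ennreal (norm (G x y - S N x y)) \<partial>Q)"
      by (simp add: ennreal_mult)
    finally have "(ennreal (norm (T x)))\<^sup>2 \<le> \<dots>\<^sup>2"
      by (intro power_mono) auto
    also have "\<dots> \<le> (\<integral>\<^sup>+y. (ennreal \<bar>\<phi> y\<bar>)\<^sup>2 \<partial>Q) * (\<integral>\<^sup>+y. (ennreal (norm (G x y - S N x y)))\<^sup>2 \<partial>Q)"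
      by (intro Cauchy_Schwarz_nn_integral) measurable
    also have "\<dots> = K * (\<integral>\<^sup>+y. ennreal ((norm (G x y - S N x y))\<^sup>2) \<partial>Q)"
      by (simp add: K_def ennreal_power)
    finally show ?thesis by (simp add: ennreal_power)
  qed
  have "(\<integral>\<^sup>+x. ennreal ((norm (T x))\<^sup>2) \<partial>P) \<le> K * E N" for N
  proof -
    have "(\<integral>\<^sup>+x. ennreal ((norm (T x))\<^sup>2) \<partial>P)
        \<le> (\<integral>\<^sup>+x. K * (\<integral>\<^sup>+y. ennreal ((norm (G x y - S N x y))\<^sup>2) \<partial>Q) \<partial>P)"
    proof (rule nn_integral_mono_AE)
      show "AE x in P. ennreal ((norm (T x))\<^sup>2)
          \<le> K * (\<integral>\<^sup>+y. ennreal ((norm (G x y - S N x y))\<^sup>2) \<partial>Q)"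
        using int_G AE_space by eventually_elim (rule T_le)
    qed
    also have "\<dots> = K * (\<integral>\<^sup>+x. (\<integral>\<^sup>+y. ennreal ((norm (G x y - S N x y))\<^sup>2) \<partial>Q) \<partial>P)"
      using Q.borel_measurable_nn_integral_fst[OF err_meas[of N]] by (simp add: nn_integral_cmult)
    also have "\<dots> = K * E N"
      using Q.nn_integral_fst[OF err_meas[of N]] by (simp add: E_def)
    finally show ?thesis .
  qed
  \<comment> \<open>Finiteness of \<open>K\<close> is essential: multiplication by infinity is not
    continuous at 0 in the extended nonnegative reals.\<close>
  moreover have "(\<lambda>N. K * E N) \<longlonglongrightarrow> K * 0"
    using \<phi>_L2 lim unfolding E_def S_def K_def by (intro ennreal_tendsto_cmult) auto
  ultimately have "(\<integral>\<^sup>+x. ennreal ((norm (T x))\<^sup>2) \<partial>P) \<le> K * 0"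
    by (intro LIMSEQ_le_const) blast+
  then have "AE x in P. ennreal ((norm (T x))\<^sup>2) = 0"
    by (simp add: nn_integral_0_iff_AE)
  then show ?thesis
    unfolding T_def by eventually_elim simp
qed

section \<open>Increments and difference quotients of a kernel with continuous Jacobian\<close>

text \<open>Subtracting the linear map \<open>B0\<close> leaves a function with derivative
  \<open>D x \<gamma> - B0\<close>, to which the mean value inequality applies. With
  \<open>B0 = 0\<close> this yields a Lipschitz bound; with \<open>B0\<close> the Jacobian at a
  point and \<open>S\<close> a small neighbourhood of it in \<open>A\<close>, it yields a
  first-order expansion.\<close>

lemma jacobian_mean_value:
  assumes jac: "has_continuous_jacobian_on A C g D"
    and S: "convex S" "interior S \<noteq> {}" "S \<subseteq> A" and \<gamma>: "\<gamma> \<in> C"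
    and bound: "\<And>x. x \<in> S \<Longrightarrow> norm (D x \<gamma> - B0) \<le> B"
    and xy: "x \<in> S" "y \<in> S"
  shows "norm (g x \<gamma> - g y \<gamma> - B0 *v (x - y)) \<le> B * norm (x - y)"
proof -
  have "norm ((g x \<gamma> - B0 *v x) - (g y \<gamma> - B0 *v y)) \<le> B * norm (x - y)"
  proof (rule convex_interior_differentiable_bound[OF S(1,2) _ _ _ xy])
    show "continuous_on S (\<lambda>x. g x \<gamma> - B0 *v x)"
      using jac \<gamma> S(3)
      by (intro continuous_intros matrix_vector_mult_linear_continuous_on)
        (auto simp: has_continuous_jacobian_on_def intro: continuous_on_subset)
    fix z assume z: "z \<in> interior S"
    then have "z \<in> interior A" using interior_mono[OF S(3)] by blast
    then show "((\<lambda>x. g x \<gamma> - B0 *v x) has_derivative (\<lambda>h. D z \<gamma> *v h - B0 *v h)) (at z)"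
      using jac \<gamma> unfolding has_continuous_jacobian_on_def
      by (intro has_derivative_diff bounded_linear_imp_has_derivative matrix_vector_mul_bounded_linear) auto
    show "norm (D z \<gamma> *v h - B0 *v h) \<le> B * norm h" for h
    proof -
      have "norm (D z \<gamma> *v h - B0 *v h) \<le> norm (D z \<gamma> - B0) * norm h"
        using norm_matrix_vector_mult_le[of "D z \<gamma> - B0" h]
        by (simp add: matrix_vector_mult_diff_rdistrib)
      also have "\<dots> \<le> B * norm h"
        using bound z interior_subset by (intro mult_right_mono) auto
      finally show ?thesis .
    qed
  qed
  then show ?thesis by (simp add: matrix_vector_mult_diff_distrib algebra_simps)
qed

text \<open>A bound for the Jacobian on the compact set \<open>A \<times> C\<close> serves as a
  Lipschitz constant, uniformly in the second variable.\<close>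

lemma jacobian_lipschitz:
  assumes jac: "has_continuous_jacobian_on A C g D"
    and A: "convex A" "interior A \<noteq> {}" "compact A" and C: "compact C"
  obtains L where "0 \<le> L"
    "\<And>x y \<gamma>. x \<in> A \<Longrightarrow> y \<in> A \<Longrightarrow> \<gamma> \<in> C \<Longrightarrow> norm (g x \<gamma> - g y \<gamma>) \<le> L * norm (x - y)"
proof -
  have "compact ((\<lambda>(x, \<gamma>). D x \<gamma>) ` (A \<times> C))"
    using jac A C by (intro compact_continuous_image compact_Times) (auto simp: has_continuous_jacobian_on_def)
  then obtain L where L: "0 < L" "\<And>x \<gamma>. x \<in> A \<Longrightarrow> \<gamma> \<in> C \<Longrightarrow> norm (D x \<gamma>) \<le> L"
    by (auto dest!: compact_imp_bounded simp: bounded_pos)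
  show thesis
  proof (rule that[of L])
    fix x y \<gamma> assume "x \<in> A" "y \<in> A" "\<gamma> \<in> C"
    then show "norm (g x \<gamma> - g y \<gamma>) \<le> L * norm (x - y)"
      using jacobian_mean_value[OF jac A(1,2) order_refl, of \<gamma> 0 L x y] L(2) by simp
  qed (use L in simp)
qed

text \<open>The function \<open>\<lambda>x. g x \<gamma>' - g x \<gamma>\<close> has derivative
  \<open>D x \<gamma>' - D x \<gamma>\<close>, which is uniformly small for close
  \<open>\<gamma>'\<close> and \<open>\<gamma>\<close> because \<open>D\<close> is uniformly
  continuous on the compact product. Its increment between \<open>x\<close> and \<open>y\<close> is
  the change of \<open>g x \<gamma> - g y \<gamma>\<close> in the second variable.\<close>

lemma jacobian_increment_continuous_on:
  fixes C :: "'y::metric_space set"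
  assumes jac: "has_continuous_jacobian_on A C g D"
    and A: "convex A" "interior A \<noteq> {}" "compact A" and C: "compact C"
    and xy: "x \<in> A" "y \<in> A"
  shows "continuous_on C (\<lambda>\<gamma>. g x \<gamma> - g y \<gamma>)"
  unfolding continuous_on_iff
proof (intro ballI allI impI)
  fix \<gamma> e assume \<gamma>: "\<gamma> \<in> C" and e: "0 < (e::real)"
  \<comment> \<open>The summand 1 covers the case \<open>x = y\<close> and makes the final estimate
    strict.\<close>
  define \<epsilon> where "\<epsilon> = e / (norm (x - y) + 1)"
  have \<epsilon>: "0 < \<epsilon>" "\<epsilon> * norm (x - y) < e"
    using e by (auto simp: \<epsilon>_def field_simps add_nonneg_pos add_pos_nonneg)
  have "uniformly_continuous_on (A \<times> C) (\<lambda>(x, \<gamma>). D x \<gamma>)"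
    using jac A C by (intro compact_uniformly_continuous compact_Times) (auto simp: has_continuous_jacobian_on_def)
  then obtain d where d: "0 < d" "\<And>z z'. z \<in> A \<times> C \<Longrightarrow> z' \<in> A \<times> C \<Longrightarrow> dist z' z < d \<Longrightarrow>
      dist (case z' of (x, \<gamma>) \<Rightarrow> D x \<gamma>) (case z of (x, \<gamma>) \<Rightarrow> D x \<gamma>) < \<epsilon>"
    using \<epsilon>(1) by (elim uniformly_continuous_onE) blast+
  show "\<exists>d>0. \<forall>\<gamma>'\<in>C. dist \<gamma>' \<gamma> < d \<longrightarrow> dist (g x \<gamma>' - g y \<gamma>') (g x \<gamma> - g y \<gamma>) < e"
  proof (intro exI[of _ d] conjI ballI impI d(1))
    fix \<gamma>' assume \<gamma>': "\<gamma>' \<in> C" "dist \<gamma>' \<gamma> < d"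
    have "norm ((g x \<gamma>' - g x \<gamma>) - (g y \<gamma>' - g y \<gamma>)) \<le> \<epsilon> * norm (x - y)"
    proof (rule convex_interior_differentiable_bound[OF A(1,2) _ _ _ xy])
      show "continuous_on A (\<lambda>x. g x \<gamma>' - g x \<gamma>)"
        using jac \<gamma> \<gamma>' by (intro continuous_intros) (auto simp: has_continuous_jacobian_on_def)
      fix z assume z: "z \<in> interior A"
      then show "((\<lambda>x. g x \<gamma>' - g x \<gamma>) has_derivative (\<lambda>h. D z \<gamma>' *v h - D z \<gamma> *v h)) (at z)"
        using jac \<gamma> \<gamma>' unfolding has_continuous_jacobian_on_def
        by (intro has_derivative_diff) auto
      have "norm (D z \<gamma>' - D z \<gamma>) \<le> \<epsilon>"
        using d(2)[of "(z, \<gamma>)" "(z, \<gamma>')"] z interior_subset \<gamma> \<gamma>'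
        by (auto simp: dist_Pair_Pair dist_norm intro: less_imp_le)
      then show "norm (D z \<gamma>' *v h - D z \<gamma> *v h) \<le> \<epsilon> * norm h" for h
        using norm_matrix_vector_mult_le[of "D z \<gamma>' - D z \<gamma>" h]
        by (simp add: matrix_vector_mult_diff_rdistrib)
          (meson mult_right_mono norm_ge_zero order_trans)
    qed
    then show "dist (g x \<gamma>' - g y \<gamma>') (g x \<gamma> - g y \<gamma>) < e"
      using \<epsilon>(2) by (simp add: dist_norm algebra_simps)
  qed
qed

text \<open>Near \<open>a\<close> the Jacobian differs little from \<open>D a \<gamma>\<close>, so
  the mean value estimate with \<open>B0 = D a \<gamma>\<close> shows that the quotient and
  \<open>D a \<gamma>\<close> applied to the unit direction have the same limit. Both points of the
  quotient may move, and \<open>a\<close> may be a boundary point.\<close>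

lemma jacobian_difference_quotient_tendsto:
  assumes jac: "has_continuous_jacobian_on A C g D"
    and A: "convex A" "interior A \<noteq> {}" and \<gamma>: "\<gamma> \<in> C" and a: "a \<in> A"
    and xy: "\<And>n. x n \<in> A" "\<And>n. y n \<in> A" "\<And>n. x n \<noteq> y n"
    and lim: "x \<longlonglongrightarrow> a" "y \<longlonglongrightarrow> a" "(\<lambda>n. (x n - y n) /\<^sub>R norm (x n - y n)) \<longlonglongrightarrow> e"
  shows "(\<lambda>n. (g (x n) \<gamma> - g (y n) \<gamma>) /\<^sub>R norm (x n - y n)) \<longlonglongrightarrow> D a \<gamma> *v e"
proof -
  define E where "E n = (x n - y n) /\<^sub>R norm (x n - y n)" for n
  define q where "q n = (g (x n) \<gamma> - g (y n) \<gamma>) /\<^sub>R norm (x n - y n)" for n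
  have contD: "continuous_on A (\<lambda>x. D x \<gamma>)"
  proof -
    have "continuous_on ((\<lambda>x. (x, \<gamma>)) ` A) (\<lambda>(x, \<gamma>). D x \<gamma>)"
      using jac \<gamma> by (auto simp: has_continuous_jacobian_on_def elim: continuous_on_subset)
    from continuous_on_compose2[OF this, of A "\<lambda>x. (x, \<gamma>)"] show ?thesis
      by (simp add: continuous_on_Pair)
  qed
  have "(\<lambda>n. q n - D a \<gamma> *v E n) \<longlonglongrightarrow> 0"
    unfolding LIMSEQ_iff
  proof (intro allI impI)
    fix r :: real assume r: "0 < r"
    obtain d where d: "0 < d" "\<And>z. z \<in> A \<Longrightarrow> dist z a < d \<Longrightarrow> norm (D z \<gamma> - D a \<gamma>) < r / 2"
      using contD a r unfolding continuous_on_iff dist_norm by (meson half_gt_zero)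
    define S where "S = A \<inter> ball a d"
    \<comment> \<open>A convex set with nonempty interior lies in the closure of its interior. Hence
      the ball around \<open>a\<close> meets \<open>interior A\<close>, and \<open>S\<close> has
      nonempty interior as the mean value estimate requires.\<close>
    have "a \<in> closure (interior A)"
      using a A convex_closure_interior closure_subset by blast
    then have "interior A \<inter> ball a d \<noteq> {}"
      using d(1) by (metis centre_in_ball closure_iff_nhds_not_empty inf_commute open_ball subset_refl)
    then have S: "convex S" "interior S \<noteq> {}" "S \<subseteq> A"
      using A(1) by (auto simp: S_def intro: convex_Int)
    have "eventually (\<lambda>n. dist (x n) a < d \<and> dist (y n) a < d) sequentially"
      using lim(1,2) d(1) by (simp add: eventually_conj tendstoD)
    then have "eventually (\<lambda>n. norm (q n - D a \<gamma> *v E n - 0) < r) sequentially"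
    proof eventually_elim
      case (elim n)
      have "norm (g (x n) \<gamma> - g (y n) \<gamma> - D a \<gamma> *v (x n - y n)) \<le> r / 2 * norm (x n - y n)"
        using elim xy d(2)
        by (intro jacobian_mean_value[OF jac S \<gamma>]) (auto simp: S_def dist_commute intro: less_imp_le)
      moreover have "q n - D a \<gamma> *v E n
          = (g (x n) \<gamma> - g (y n) \<gamma> - D a \<gamma> *v (x n - y n)) /\<^sub>R norm (x n - y n)"
        by (simp add: q_def E_def matrix_vector_mult_scaleR flip: scaleR_diff_right)
      then have "norm (q n - D a \<gamma> *v E n)
          = norm (g (x n) \<gamma> - g (y n) \<gamma> - D a \<gamma> *v (x n - y n)) / norm (x n - y n)"
        by (simp only: norm_scaleR abs_inverse abs_norm_cancel divide_inverse mult.commute)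
      ultimately have "norm (q n - D a \<gamma> *v E n) \<le> r / 2"
        using xy(3)[of n] by (simp only: pos_divide_le_eq zero_less_norm_iff right_minus_eq not_False_eq_True)
      then show ?case using r by simp
    qed
    then show "\<exists>N. \<forall>n\<ge>N. norm (q n - D a \<gamma> *v E n - 0) < r"
      by (simp add: eventually_sequentially)
  qed
  moreover have "(\<lambda>n. D a \<gamma> *v E n) \<longlonglongrightarrow> D a \<gamma> *v e"
    using lim(3) unfolding E_def
    by (rule bounded_linear.tendsto[OF matrix_vector_mul_bounded_linear])
  ultimately have "(\<lambda>n. (q n - D a \<gamma> *v E n) + D a \<gamma> *v E n) \<longlonglongrightarrow> 0 + D a \<gamma> *v e"
    by (rule tendsto_add)
  then show ?thesis by (simp add: q_def)
qed

text \<open>Compactness of \<open>A \<times> A \<times> sphere 0 1\<close> gives a subsequence along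
  which both points and their normalised difference converge. If the two limit points differ, the
  quotients converge to their difference quotient; if they coincide, to the derivative in the limit
  direction.\<close>

lemma difference_quotient_limit:
  fixes C :: "'y::metric_space set"
  assumes jac: "has_continuous_jacobian_on A C g D"
    and A: "convex A" "interior A \<noteq> {}" "compact A" and C: "compact C"
    and xy: "\<And>n::nat. x n \<in> A" "\<And>n. y n \<in> A" "\<And>n. x n \<noteq> y n"
  obtains s q where "strict_mono s" "continuous_on C q"
    "\<And>\<gamma>. \<gamma> \<in> C \<Longrightarrow>
       (\<lambda>n. (g (x (s n)) \<gamma> - g (y (s n)) \<gamma>) /\<^sub>R norm (x (s n) - y (s n))) \<longlonglongrightarrow> q \<gamma>"
    "(\<exists>a\<in>A. \<exists>b\<in>A. a \<noteq> b \<and> (\<forall>\<gamma>\<in>C. q \<gamma> = (g a \<gamma> - g b \<gamma>) /\<^sub>R norm (a - b))) \<or>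
     (\<exists>a\<in>A. \<exists>e. norm e = 1 \<and> (\<forall>\<gamma>\<in>C. q \<gamma> = D a \<gamma> *v e))"
proof -
  define E where "E n = (x n - y n) /\<^sub>R norm (x n - y n)" for n
  have E: "E n \<in> sphere 0 1" for n
    using xy(3) by (simp add: E_def)
  have "compact (A \<times> A \<times> sphere (0::real^'a) 1)"
    using A(3) by (intro compact_Times) auto
  moreover have "\<forall>n. (x n, y n, E n) \<in> A \<times> A \<times> sphere 0 1"
    using xy E by blast
  ultimately obtain l s where l: "l \<in> A \<times> A \<times> sphere 0 1" and s: "strict_mono s"
    and lim: "((\<lambda>n. (x n, y n, E n)) \<circ> s) \<longlonglongrightarrow> l"
    by (rule seq_compactE[OF compact_imp_seq_compact])
  obtain a b e where abe: "l = (a, b, e)" by (cases l)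
  have ab: "a \<in> A" "b \<in> A" "norm e = 1" using l abe by auto
  have lims: "(\<lambda>n. x (s n)) \<longlonglongrightarrow> a" "(\<lambda>n. y (s n)) \<longlonglongrightarrow> b" "(\<lambda>n. E (s n)) \<longlonglongrightarrow> e"
    using tendsto_fst[OF lim] tendsto_fst[OF tendsto_snd[OF lim]] tendsto_snd[OF tendsto_snd[OF lim]]
    by (simp_all add: abe o_def)
  show thesis
  proof (cases "a = b")
    case True
    have "continuous_on ((\<lambda>\<gamma>. (a, \<gamma>)) ` C) (\<lambda>(x, \<gamma>). D x \<gamma>)"
      using jac ab by (auto simp: has_continuous_jacobian_on_def elim: continuous_on_subset)
    from continuous_on_compose2[OF this, of C "\<lambda>\<gamma>. (a, \<gamma>)"]
    have contD: "continuous_on C (\<lambda>\<gamma>. D a \<gamma>)"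
      by (simp add: continuous_on_Pair)
    show thesis
    proof (rule that[OF s, of "\<lambda>\<gamma>. D a \<gamma> *v e"])
      show "continuous_on C (\<lambda>\<gamma>. D a \<gamma> *v e)"
        using contD unfolding matrix_vector_mult_def by (intro continuous_intros)
      show "(\<lambda>n. (g (x (s n)) \<gamma> - g (y (s n)) \<gamma>) /\<^sub>R norm (x (s n) - y (s n))) \<longlonglongrightarrow> D a \<gamma> *v e"
        if "\<gamma> \<in> C" for \<gamma>
        using jacobian_difference_quotient_tendsto[OF jac A(1,2) that ab(1),
            of "\<lambda>n. x (s n)" "\<lambda>n. y (s n)" e] xy lims True
        by (simp add: E_def)
    qed (use ab in blast)
  next
    case False
    show thesis
    proof (rule that[OF s, of "\<lambda>\<gamma>. (g a \<gamma> - g b \<gamma>) /\<^sub>R norm (a - b)"])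
      show "continuous_on C (\<lambda>\<gamma>. (g a \<gamma> - g b \<gamma>) /\<^sub>R norm (a - b))"
        by (intro continuous_intros jacobian_increment_continuous_on[OF jac A C] ab)
      fix \<gamma> assume "\<gamma> \<in> C"
      then have cont: "continuous_on A (\<lambda>x. g x \<gamma>)"
        using jac by (simp add: has_continuous_jacobian_on_def)
      show "(\<lambda>n. (g (x (s n)) \<gamma> - g (y (s n)) \<gamma>) /\<^sub>R norm (x (s n) - y (s n)))
          \<longlonglongrightarrow> (g a \<gamma> - g b \<gamma>) /\<^sub>R norm (a - b)"
        using False xy ab
        by (intro tendsto_intros lims continuous_on_tendsto_compose[OF cont]) auto
    qed (use ab False in blast)
  qed
qed

section \<open>Integral bounds and square-integrable functions\<close>

text \<open>A non-integrable function has Bochner integral 0, a case settled by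
  \<open>0 \<le> c\<close>.\<close>

lemma (in prob_space) norm_integral_le_const:
  fixes f :: "'a \<Rightarrow> 'b::{banach, second_countable_topology}"
  assumes "0 \<le> c" "\<And>x. norm (f x) \<le> c"
  shows "norm (\<integral>x. f x \<partial>M) \<le> c"
proof (cases "integrable M f")
  case True
  have "norm (\<integral>x. f x \<partial>M) \<le> (\<integral>x. norm (f x) \<partial>M)" by (rule integral_norm_bound)
  also have "\<dots> \<le> c" using True assms(2) by (intro integral_le_const) auto
  finally show ?thesis .
qed (simp add: not_integrable_integral_eq assms)

lemma integrable_scaleR_L2:
  fixes h :: "'x \<Rightarrow> 'b::euclidean_space" and f :: "'x \<Rightarrow> real"
  assumes [measurable]: "f \<in> borel_measurable M" "h \<in> borel_measurable M"
    and "integrable M (\<lambda>x. (norm (f x))\<^sup>2)" "integrable M (\<lambda>x. (norm (h x))\<^sup>2)"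
  shows "integrable M (\<lambda>x. f x *\<^sub>R h x)"
proof (rule Bochner_Integration.integrable_bound)
  show "integrable M (\<lambda>x. (norm (f x))\<^sup>2 + (norm (h x))\<^sup>2)"
    using assms(3,4) by (rule Bochner_Integration.integrable_add)
  have "\<bar>a\<bar> * b \<le> a\<^sup>2 + b\<^sup>2" if "0 \<le> b" for a b :: real
  proof -
    have "0 \<le> \<bar>a\<bar> * b" using that by simp
    moreover have "2 * (\<bar>a\<bar> * b) \<le> a\<^sup>2 + b\<^sup>2"
      using sum_squares_bound[of "\<bar>a\<bar>" b] by (simp add: mult.assoc)
    ultimately show ?thesis by linarith
  qed
  then show "AE x in M. norm (f x *\<^sub>R h x) \<le> norm ((norm (f x))\<^sup>2 + (norm (h x))\<^sup>2)"
    by (intro AE_I2) (simp add: abs_of_nonneg)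
qed measurable

text \<open>Cutting off by the indicator passes from integrals over a set to integrals over the
  whole space, since \<open>in_L2\<close> constrains \<open>f\<close> only on the set.\<close>

lemma in_L2_indicator:
  assumes "in_L2 P \<Omega> f"
  shows "(\<lambda>x. indicator \<Omega> x *\<^sub>R f x) \<in> borel_measurable P"
    and "integrable P (\<lambda>x. (norm (indicator \<Omega> x *\<^sub>R f x))\<^sup>2)"
proof -
  show [measurable]: "(\<lambda>x. indicator \<Omega> x *\<^sub>R f x) \<in> borel_measurable P"
    using assms by (simp add: in_L2_def set_borel_measurable_def)
  have "ennreal (norm ((norm (indicator \<Omega> x *\<^sub>R f x))\<^sup>2)) = ennreal ((norm (f x))\<^sup>2) * indicator \<Omega> x" for x
    by (simp split: split_indicator)
  then have "(\<integral>\<^sup>+x. ennreal (norm ((norm (indicator \<Omega> x *\<^sub>R f x))\<^sup>2)) \<partial>P) < \<infinity>"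
    using assms by (simp only: in_L2_def)
  then show "integrable P (\<lambda>x. (norm (indicator \<Omega> x *\<^sub>R f x))\<^sup>2)"
    by (rule integrableI_bounded[rotated]) measurable
qed

section \<open>Kernels that are Lipschitz on the supports of two measures\<close>

text \<open>Of the Jacobian only the Lipschitz constant \<open>L\<close> is retained here;
  convergence of the difference quotients and continuity of their limit enter as hypotheses of
  \<open>difference_quotient_limit_eq_0\<close>.\<close>

locale lipschitz_kernel = P: prob_space P + Q: prob_space Q
  for P :: "'x::euclidean_space measure" and Q :: "'y::euclidean_space measure" +
  fixes A :: "'x set" and C :: "'y set" and g :: "'x \<Rightarrow> 'y \<Rightarrow> 'b::euclidean_space" and L :: real
  assumes sets_P [measurable_cong]: "sets P = sets borel"
    and sets_Q [measurable_cong]: "sets Q = sets borel"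
    and A_eq: "A = measure_support P" and C_eq: "C = measure_support Q"
    and compact_A: "compact A" and compact_C: "compact C"
    and g_measurable: "set_borel_measurable (P \<Otimes>\<^sub>M Q) (A \<times> C) (\<lambda>(x, y). g x y)"
    and g_L2: "(\<integral>\<^sup>+x\<in>A. (\<integral>\<^sup>+y\<in>C. ennreal ((norm (g x y))\<^sup>2) \<partial>Q) \<partial>P) < \<infinity>"
    and L_nonneg: "0 \<le> L"
    and lipschitz: "\<And>x x' y. x \<in> A \<Longrightarrow> x' \<in> A \<Longrightarrow> y \<in> C \<Longrightarrow> norm (g x y - g x' y) \<le> L * norm (x - x')"
begin

text \<open>The cutoff in the second variable turns integrals over \<open>C\<close> into integrals
  over the whole space and makes the Lipschitz bound valid for every \<open>y\<close>. The first
  variable is cut off separately where product measurability is needed.\<close>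

definition G :: "'x \<Rightarrow> 'y \<Rightarrow> 'b" where
  "G x y = indicator C y *\<^sub>R g x y"

lemma sets_A_C [measurable]: "A \<in> sets borel" "C \<in> sets borel"
  using compact_A compact_C by (auto intro: borel_compact)

lemma space_P_Q [simp]: "space P = UNIV" "space Q = UNIV"
  using sets_eq_imp_space_eq[OF sets_P] sets_eq_imp_space_eq[OF sets_Q] by simp_all

lemma AE_A: "AE x in P. x \<in> A" and AE_C: "AE y in Q. y \<in> C"
  using AE_in_measure_support[OF sets_P] AE_in_measure_support[OF sets_Q] A_eq C_eq by simp_all

lemma G_measurable: "(\<lambda>(x, y). indicator A x *\<^sub>R G x y) \<in> borel_measurable (P \<Otimes>\<^sub>M Q)"
proof -
  have "(\<lambda>(x, y). indicator A x *\<^sub>R G x y) = (\<lambda>z. indicator (A \<times> C) z *\<^sub>R (case z of (x, y) \<Rightarrow> g x y))"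
    by (auto simp: G_def fun_eq_iff split: split_indicator)
  then show ?thesis using g_measurable by (simp add: set_borel_measurable_def)
qed

lemma G_section_measurable [measurable]: "x \<in> A \<Longrightarrow> G x \<in> borel_measurable Q"
  using measurable_Pair2[OF G_measurable, of x] by simp

lemma G_lipschitz: "x \<in> A \<Longrightarrow> x' \<in> A \<Longrightarrow> norm (G x y - G x' y) \<le> L * norm (x - x')"
  using lipschitz L_nonneg by (simp add: G_def split: split_indicator)

text \<open>Finiteness of the double integral makes almost every section square integrable, in
  particular that of some \<open>z \<in> A\<close>. The Lipschitz bound carries this to every
  \<open>x \<in> A\<close>, as the two sections differ by at most a constant and \<open>Q\<close> is
  finite.\<close>

lemma G_section_L2:
  assumes x: "x \<in> A"
  shows "integrable Q (\<lambda>y. (norm (G x y))\<^sup>2)"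
proof -
  define N where "N x = (\<integral>\<^sup>+y\<in>C. ennreal ((norm (g x y))\<^sup>2) \<partial>Q)" for x
  have N_eq: "N x * indicator A x = (\<integral>\<^sup>+y. ennreal ((norm (indicator A x *\<^sub>R G x y))\<^sup>2) \<partial>Q)" for x
    unfolding N_def G_def
    by (cases "x \<in> A") (auto intro!: nn_integral_cong split: split_indicator)
  have "(\<lambda>(x, y). ennreal ((norm (indicator A x *\<^sub>R G x y))\<^sup>2)) \<in> borel_measurable (P \<Otimes>\<^sub>M Q)"
    using G_measurable unfolding case_prod_beta by measurable
  from Q.borel_measurable_nn_integral_fst[OF this]
  have "(\<lambda>x. N x * indicator A x) \<in> borel_measurable P" by (simp add: N_eq)
  then have "AE x in P. N x * indicator A x \<noteq> \<infinity>"
    using g_L2 by (intro nn_integral_PInf_AE) (auto simp: N_def)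
  with AE_A have "AE x in P. x \<in> A \<and> N x < \<infinity>"
    by eventually_elim (simp add: less_top)
  then obtain z where z: "z \<in> A" "N z < \<infinity>"
    using eventually_happens'[OF P.ae_filter_bot] by blast
  have "N z = (\<integral>\<^sup>+y. ennreal (norm ((norm (G z y))\<^sup>2)) \<partial>Q)"
    unfolding N_def G_def by (intro nn_integral_cong) (simp split: split_indicator)
  then have z_L2: "integrable Q (\<lambda>y. (norm (G z y))\<^sup>2)"
    using z by (intro integrableI_bounded) auto
  define c where "c = (L * norm (x - z))\<^sup>2"
  show ?thesis
  proof (rule Bochner_Integration.integrable_bound)
    show "integrable Q (\<lambda>y. 2 * (norm (G z y))\<^sup>2 + 2 * c)"
      using z_L2 by simp
    have "(norm (G x y))\<^sup>2 \<le> 2 * (norm (G z y))\<^sup>2 + 2 * c" for y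
    proof -
      have "norm (G x y) \<le> norm (G z y) + L * norm (x - z)"
        using G_lipschitz[OF x z(1), of y] norm_triangle_ineq2[of "G x y" "G z y"] by simp
      then have "(norm (G x y))\<^sup>2 \<le> (norm (G z y) + L * norm (x - z))\<^sup>2"
        by (intro power_mono) auto
      also have "\<dots> \<le> 2 * (norm (G z y))\<^sup>2 + 2 * c"
        using sum_squares_bound[of "norm (G z y)" "L * norm (x - z)"] by (simp add: c_def power2_sum)
      finally show ?thesis .
    qed
    then show "AE y in Q. norm ((norm (G x y))\<^sup>2) \<le> norm (2 * (norm (G z y))\<^sup>2 + 2 * c)"
      by (intro AE_I2) (simp add: c_def)
  qed (use x in measurable)
qed

lemma integrable_scaleR_G:
  assumes "in_L2 Q C f" "x \<in> A"
  shows "integrable Q (\<lambda>y. (indicator C y *\<^sub>R f y) *\<^sub>R G x y)"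
  using assms by (intro integrable_scaleR_L2 in_L2_indicator G_section_L2) auto

lemma kernel_op_eq: "kernel_op Q C g f x = (\<integral>y. (indicator C y *\<^sub>R f y) *\<^sub>R G x y \<partial>Q)"
  unfolding kernel_op_def set_lebesgue_integral_def G_def
  by (intro Bochner_Integration.integral_cong) (auto split: split_indicator)

lemma integrable_bounded_scaleR_G:
  fixes \<phi> :: "'y \<Rightarrow> real"
  assumes [measurable]: "\<phi> \<in> borel_measurable Q" and bound: "\<And>y. \<bar>\<phi> y\<bar> \<le> B" and x: "x \<in> A"
  shows "integrable Q (\<lambda>y. \<phi> y *\<^sub>R G x y)"
proof (intro integrable_scaleR_L2 G_section_L2 x)
  show "integrable Q (\<lambda>y. (norm (\<phi> y))\<^sup>2)"
    using bound
    by (intro Q.integrable_const_bound[of _ "B\<^sup>2"] AE_I2)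
      (auto simp: abs_le_square_iff[symmetric] intro: order_trans[OF _ abs_ge_self])
qed (use x in measurable)

text \<open>The singular expansion gives the equation for almost every \<open>x\<close>. The
  left-hand side is Lipschitz in \<open>x\<close> on \<open>A\<close>, and \<open>A\<close> is the
  support of \<open>P\<close>, so the exceptional points disappear.\<close>

lemma integral_scaleR_G_eq_0:
  assumes svd: "singular_system P A Q C g M \<sigma> u v"
    and \<phi> [measurable]: "\<phi> \<in> borel_measurable Q" and bound: "\<And>y. \<bar>\<phi> y\<bar> \<le> B"
    and orth: "\<And>r. r \<in> sv_index M \<Longrightarrow> (\<integral>y. \<phi> y * (indicator C y * v r y) \<partial>Q) = 0"
    and x: "x \<in> A"
  shows "(\<integral>y. \<phi> y *\<^sub>R G x y \<partial>Q) = 0"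
proof -
  have u: "in_L2 P A (u r)" and v: "in_L2 Q C (v r)" if "r \<in> sv_index M" for r
    using svd that by (auto simp: singular_system_def orthonormal_L2_def)
  \<comment> \<open>The point is arbitrary: \<open>B\<close> bounds an absolute value.\<close>
  have B: "0 \<le> B" using bound[of undefined] by simp
  have \<phi>_L2: "integrable Q (\<lambda>y. (norm (\<phi> y))\<^sup>2)"
    using bound B by (intro Q.integrable_const_bound[of _ "B\<^sup>2"] AE_I2) (auto simp: abs_le_square_iff[symmetric])
  have AE_0: "AE x in P. (\<integral>y. \<phi> y *\<^sub>R (indicator A x *\<^sub>R G x y) \<partial>Q) = 0"
  proof (rule AE_integral_eq_0_if_orthogonal[where I = "sv_index M" and \<sigma> = \<sigma>
        and u = "\<lambda>r x. indicator A x *\<^sub>R u r x" and v = "\<lambda>r y. indicator C y *\<^sub>R v r y"])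
    show "(\<integral>\<^sup>+y. ennreal ((\<phi> y)\<^sup>2) \<partial>Q) < \<infinity>"
      using \<phi>_L2 by (simp add: integrable_iff_bounded)
    show "AE x in P. integrable Q (\<lambda>y. \<phi> y *\<^sub>R (indicator A x *\<^sub>R G x y))"
      using AE_A by eventually_elim (simp add: integrable_bounded_scaleR_G[OF \<phi> bound])
    show "integrable Q (\<lambda>y. \<phi> y * (indicator C y *\<^sub>R v r y))" if "r \<in> sv_index M" for r
      using integrable_scaleR_L2[OF \<phi> in_L2_indicator(1)[OF v[OF that]] \<phi>_L2 in_L2_indicator(2)[OF v[OF that]]]
      by simp
    \<comment> \<open>Off \<open>A \<times> C\<close> the cutoffs annihilate both the kernel and the
      partial sum, so this is the error in \<open>singular_system\<close>.\<close>
    have "(\<integral>\<^sup>+z. (case z of (x, y) \<Rightarrow> ennreal ((norm (indicator A x *\<^sub>R G x y -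
          (\<Sum>r\<in>sv_index M \<inter> {..N}. (\<sigma> r * (indicator C y *\<^sub>R v r y)) *\<^sub>R indicator A x *\<^sub>R u r x)))\<^sup>2)) \<partial>(P \<Otimes>\<^sub>M Q))
        = (\<integral>\<^sup>+z\<in>A \<times> C. (case z of (x, y) \<Rightarrow> ennreal ((norm (g x y -
          (\<Sum>r\<in>sv_index M \<inter> {..N}. (\<sigma> r * v r y) *\<^sub>R u r x)))\<^sup>2)) \<partial>(P \<Otimes>\<^sub>M Q))" for N
    proof (intro nn_integral_cong, goal_cases)
      case (1 z)
      show ?case
        by (cases z; cases "fst z \<in> A"; cases "snd z \<in> C") (simp_all add: G_def)
    qed
    then show "(\<lambda>N. \<integral>\<^sup>+z. (case z of (x, y) \<Rightarrow> ennreal ((norm (indicator A x *\<^sub>R G x y -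
          (\<Sum>r\<in>sv_index M \<inter> {..N}. (\<sigma> r * (indicator C y *\<^sub>R v r y)) *\<^sub>R indicator A x *\<^sub>R u r x)))\<^sup>2)) \<partial>(P \<Otimes>\<^sub>M Q))
        \<longlonglongrightarrow> 0"
      using svd by (simp only: singular_system_def)
  qed (use G_measurable in_L2_indicator(1)[OF u] in_L2_indicator(1)[OF v] orth
      in \<open>auto intro: Q.sigma_finite_measure_axioms\<close>)
  have "continuous_on A (\<lambda>x. \<integral>y. \<phi> y *\<^sub>R G x y \<partial>Q)"
  proof (rule lipschitz_on_continuous_on[OF lipschitz_onI])
    fix x x' assume xx': "x \<in> A" "x' \<in> A"
    have "(\<integral>y. \<phi> y *\<^sub>R G x y \<partial>Q) - (\<integral>y. \<phi> y *\<^sub>R G x' y \<partial>Q)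
        = (\<integral>y. \<phi> y *\<^sub>R (G x y - G x' y) \<partial>Q)"
      by (simp add: scaleR_diff_right integrable_bounded_scaleR_G[OF \<phi> bound] xx')
    moreover have "norm (\<integral>y. \<phi> y *\<^sub>R (G x y - G x' y) \<partial>Q) \<le> B * (L * norm (x - x'))"
      using B L_nonneg bound G_lipschitz[OF xx']
      by (intro Q.norm_integral_le_const) (auto intro!: mult_mono)
    ultimately show "dist (\<integral>y. \<phi> y *\<^sub>R G x y \<partial>Q) (\<integral>y. \<phi> y *\<^sub>R G x' y \<partial>Q) \<le> (B * L) * dist x x'"
      by (simp add: dist_norm mult.assoc)
  qed (use B L_nonneg in simp)
  moreover have "AE x in P. x \<in> A \<longrightarrow> (\<integral>y. \<phi> y *\<^sub>R G x y \<partial>Q) = 0"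
    using AE_0 by eventually_elim (rule impI, simp)
  ultimately show ?thesis
    using AE_eq_0_imp_eq_0_on_support[OF sets_P, of "\<lambda>x. \<integral>y. \<phi> y *\<^sub>R G x y \<partial>Q" x] AE_A x A_eq by simp
qed

text \<open>Dominated convergence is used twice, with \<open>L\<close> bounding all quotients: first
  against the right singular functions, then against a component of the limit itself.\<close>

lemma difference_quotient_limit_eq_0:
  assumes svd: "singular_system P A Q C g M \<sigma> u v"
    and u_version: "\<And>r x. r \<in> sv_index M \<Longrightarrow> x \<in> A \<Longrightarrow> u r x = inverse (\<sigma> r) *\<^sub>R kernel_op Q C g (v r) x"
    and ab: "\<And>n::nat. a n \<in> A" "\<And>n. b n \<in> A" "\<And>n. a n \<noteq> b n"
    and u_eq: "\<And>n r. r \<in> sv_index M \<Longrightarrow> r \<le> n \<Longrightarrow> u r (a n) = u r (b n)"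
    and s: "strict_mono s" and cont: "continuous_on C q"
    and lim: "\<And>y. y \<in> C \<Longrightarrow>
       (\<lambda>n. (g (a (s n)) y - g (b (s n)) y) /\<^sub>R norm (a (s n) - b (s n))) \<longlonglongrightarrow> q y"
    and y: "y \<in> C"
  shows "q y = 0"
proof -
  define z where "z n y = (G (a n) y - G (b n) y) /\<^sub>R norm (a n - b n)" for n y
  define q' where "q' y = indicator C y *\<^sub>R q y" for y
  define w where "w r y = indicator C y *\<^sub>R v r y" for r y
  have z_lim: "(\<lambda>n. z (s n) y) \<longlonglongrightarrow> q' y" for y
    using lim[of y] by (cases "y \<in> C") (simp_all add: z_def q'_def G_def)
  have [measurable]: "z n \<in> borel_measurable Q" for n
    using ab unfolding z_def by measurable
  \<comment> \<open>In this form linearity of the integral reduces integrals against a quotient to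
    integrals against two sections of \<open>G\<close>.\<close>
  have z_scaleR: "t *\<^sub>R z n y = inverse (norm (a n - b n)) *\<^sub>R (t *\<^sub>R G (a n) y - t *\<^sub>R G (b n) y)" for t n y
    by (simp add: z_def scaleR_diff_right mult.commute)
  have z_bound: "norm (z n y) \<le> L" for n y
  proof -
    have "norm (z n y) = norm (G (a n) y - G (b n) y) / norm (a n - b n)"
      by (simp only: z_def norm_scaleR abs_inverse abs_norm_cancel divide_inverse mult.commute)
    then show ?thesis
      using G_lipschitz[OF ab(1)[of n] ab(2)[of n], of y] ab(3)[of n] by (simp add: pos_divide_le_eq)
  qed
  have [measurable]: "q' \<in> borel_measurable Q"
    using borel_measurable_LIMSEQ_metric[of "\<lambda>n. z (s n)" Q q'] z_lim by simp
  have q'_bound: "norm (q' y) \<le> L" for y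
    using z_bound by (intro LIMSEQ_le_const2[OF tendsto_norm[OF z_lim]]) blast
  have v: "in_L2 Q C (v r)" if "r \<in> sv_index M" for r
    using svd that by (auto simp: singular_system_def orthonormal_L2_def)
  have w_meas: "w r \<in> borel_measurable Q" and w_int: "integrable Q (w r)" if "r \<in> sv_index M" for r
  proof -
    show "w r \<in> borel_measurable Q"
      using in_L2_indicator(1)[OF v[OF that]] unfolding w_def .
    have "integrable Q (\<lambda>y. (norm (w r y))\<^sup>2)"
      using in_L2_indicator(2)[OF v[OF that]] unfolding w_def .
    then have "integrable Q (\<lambda>y. (w r y)\<^sup>2)" by simp
    with \<open>w r \<in> borel_measurable Q\<close> show "integrable Q (w r)"
      by (rule Q.square_integrable_imp_integrable)
  qed
  have z_orth: "(\<integral>y. w r y *\<^sub>R z n y \<partial>Q) = 0" if r: "r \<in> sv_index M" "r \<le> n" for r n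
  proof -
    \<comment> \<open>Positivity allows cancelling \<open>inverse (\<sigma> r)\<close>, so equal
      values of \<open>u r\<close> give equal values of the kernel operator at
      \<open>v r\<close>.\<close>
    have "0 < \<sigma> r" using svd r by (simp add: singular_system_def)
    then have "kernel_op Q C g (v r) (a n) = kernel_op Q C g (v r) (b n)"
      using u_eq[OF r] u_version[OF r(1)] ab by simp
    then show ?thesis
      using integrable_scaleR_G[OF v[OF r(1)] ab(1)[of n]] integrable_scaleR_G[OF v[OF r(1)] ab(2)[of n]]
      by (simp add: z_scaleR kernel_op_eq w_def)
  qed
  have q_orth: "(\<integral>y. w r y *\<^sub>R q' y \<partial>Q) = 0" if r: "r \<in> sv_index M" for r
  proof (rule LIMSEQ_unique)
    show "(\<lambda>n. \<integral>y. w r y *\<^sub>R z (s n) y \<partial>Q) \<longlonglongrightarrow> (\<integral>y. w r y *\<^sub>R q' y \<partial>Q)"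
    proof (rule integral_dominated_convergence)
      show "integrable Q (\<lambda>y. \<bar>w r y\<bar> * L)" using w_int[OF r] by simp
      show "AE y in Q. (\<lambda>n. w r y *\<^sub>R z (s n) y) \<longlonglongrightarrow> w r y *\<^sub>R q' y"
        by (intro AE_I2 tendsto_scaleR tendsto_const z_lim)
      show "AE y in Q. norm (w r y *\<^sub>R z (s n) y) \<le> \<bar>w r y\<bar> * L" for n
        by (intro AE_I2) (simp add: z_bound mult_left_mono)
    qed (use w_meas[OF r] in measurable)
    \<comment> \<open>Since \<open>n \<le> s n\<close>, the quotient with index \<open>s n\<close>
      is orthogonal to \<open>w r\<close> as soon as \<open>r \<le> n\<close>; the sequence is
      eventually 0.\<close>
    have "(\<integral>y. w r y *\<^sub>R z (s n) y \<partial>Q) = 0" if "r \<le> n" for n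
      using z_orth[OF r] seq_suble[OF s, of n] that by simp
    then show "(\<lambda>n. \<integral>y. w r y *\<^sub>R z (s n) y \<partial>Q) \<longlonglongrightarrow> 0"
      by (intro tendsto_eventually eventually_sequentiallyI[of r])
  qed
  have "q y \<bullet> c = 0" if c: "c \<in> Basis" for c
  proof -
    define \<phi> where "\<phi> y = q' y \<bullet> c" for y
    have [measurable]: "\<phi> \<in> borel_measurable Q" unfolding \<phi>_def by measurable
    have \<phi>_bound: "\<bar>\<phi> y\<bar> \<le> L" for y
      using Basis_le_norm[OF c, of "q' y"] q'_bound[of y] by (simp add: \<phi>_def)
    have "(\<integral>y. \<phi> y * (indicator C y * v r y) \<partial>Q) = 0" if r: "r \<in> sv_index M" for r
    proof -
      have "integrable Q (\<lambda>y. w r y *\<^sub>R q' y)"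
      proof (rule Bochner_Integration.integrable_bound)
        show "integrable Q (\<lambda>y. \<bar>w r y\<bar> * L)" using w_int[OF r] by simp
        show "AE y in Q. norm (w r y *\<^sub>R q' y) \<le> norm (\<bar>w r y\<bar> * L)"
          using L_nonneg by (intro AE_I2) (simp add: q'_bound mult_left_mono abs_mult)
      qed (use w_meas[OF r] in measurable)
      then have "(\<integral>y. (w r y *\<^sub>R q' y) \<bullet> c \<partial>Q) = (\<integral>y. w r y *\<^sub>R q' y \<partial>Q) \<bullet> c"
        by (rule integral_inner_left)
      then have "(\<integral>y. (w r y *\<^sub>R q' y) \<bullet> c \<partial>Q) = 0"
        unfolding q_orth[OF r] by (simp only: inner_zero_left)
      then show ?thesis by (simp add: \<phi>_def w_def mult_ac)
    qed
    then have G_0: "(\<integral>y. \<phi> y *\<^sub>R G x y \<partial>Q) = 0" if "x \<in> A" for x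
      using integral_scaleR_G_eq_0[OF svd _ \<phi>_bound _ that] by simp
    \<comment> \<open>Each quotient is a combination of two sections of \<open>G\<close>, and
      \<open>\<phi>\<close> integrates to 0 against both.\<close>
    have "(\<integral>y. \<phi> y *\<^sub>R z n y \<partial>Q) = 0" for n
      using integrable_bounded_scaleR_G[OF _ \<phi>_bound ab(1)[of n]]
        integrable_bounded_scaleR_G[OF _ \<phi>_bound ab(2)[of n]] G_0 ab
      by (simp add: z_scaleR)
    moreover have "(\<lambda>n. \<integral>y. \<phi> y *\<^sub>R z (s n) y \<partial>Q) \<longlonglongrightarrow> (\<integral>y. \<phi> y *\<^sub>R q' y \<partial>Q)"
    proof (rule integral_dominated_convergence)
      show "integrable Q (\<lambda>y. L * L)" by simp
      show "AE y in Q. (\<lambda>n. \<phi> y *\<^sub>R z (s n) y) \<longlonglongrightarrow> \<phi> y *\<^sub>R q' y"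
        by (intro AE_I2 tendsto_scaleR tendsto_const z_lim)
      show "AE y in Q. norm (\<phi> y *\<^sub>R z (s n) y) \<le> L * L" for n
        using L_nonneg by (intro AE_I2) (simp add: z_bound \<phi>_bound mult_mono)
    qed measurable
    ultimately have q_0: "(\<integral>y. \<phi> y *\<^sub>R q' y \<partial>Q) = 0"
      by (simp add: LIMSEQ_const_iff)
    have "integrable Q (\<lambda>y. \<phi> y *\<^sub>R q' y)"
      using L_nonneg
      by (intro Q.integrable_const_bound[of _ "L * L"] AE_I2) (simp_all add: q'_bound \<phi>_bound mult_mono)
    then have "(\<integral>y. (\<phi> y *\<^sub>R q' y) \<bullet> c \<partial>Q) = (\<integral>y. \<phi> y *\<^sub>R q' y \<partial>Q) \<bullet> c"
      "integrable Q (\<lambda>y. (\<phi> y *\<^sub>R q' y) \<bullet> c)"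
      by (rule integral_inner_left, rule integrable_inner_left)
    \<comment> \<open>The component along \<open>c\<close> of \<open>\<phi> y *\<^sub>R q' y\<close>
      is the square of \<open>\<phi> y\<close>, so the vanishing vector integral forces
      \<open>\<phi>\<close> to vanish almost everywhere.\<close>
    then have "(\<integral>y. \<phi> y * \<phi> y \<partial>Q) = 0" "integrable Q (\<lambda>y. \<phi> y * \<phi> y)"
      unfolding q_0 inner_scaleR_left \<phi>_def[symmetric] inner_zero_left .
    then have "AE y in Q. \<phi> y * \<phi> y = 0"
      by (subst integral_nonneg_eq_0_iff_AE[symmetric]) simp_all
    then have "AE y in Q. y \<in> measure_support Q \<longrightarrow> q y \<bullet> c = 0"
      by eventually_elim (rule impI, simp add: \<phi>_def q'_def C_eq)
    moreover have "continuous_on (measure_support Q) (\<lambda>y. q y \<bullet> c)"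
      using cont by (simp add: C_eq continuous_on_inner)
    ultimately show "q y \<bullet> c = 0"
      using AE_eq_0_imp_eq_0_on_support[OF sets_Q, of "\<lambda>y. q y \<bullet> c" y] AE_C y by (simp add: C_eq)
  qed
  then have "q y \<bullet> c = 0 \<bullet> c" if "c \<in> Basis" for c
    using that by simp
  then show ?thesis by (rule euclidean_eqI)
qed

end

section \<open>Injectivity of the leading truncations\<close>

text \<open>A convex set with empty interior is Lebesgue null, hence null for a measure with a
  Lebesgue density, whereas \<open>A\<close> carries the full mass 1.\<close>

lemma interior_nonempty_if_density:
  fixes P :: "'x::euclidean_space measure"
  assumes "prob_space P" and P: "P = density lborel f" "f \<in> borel_measurable borel"
    and A: "convex A" "A \<in> sets borel" "AE x in P. x \<in> A"
  shows "interior A \<noteq> {}"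
proof
  interpret P: prob_space P by fact
  assume "interior A = {}"
  then have "A \<in> null_sets lebesgue"
    using A(1) by (simp add: negligible_convex_interior flip: negligible_iff_null_sets)
  then have "A \<in> null_sets lborel"
    using A(2) by (simp add: null_sets_completion_iff)
  then have "AE x in lborel. x \<notin> A"
    by (rule AE_not_in)
  then have "AE x in P. x \<notin> A"
    using P by (auto simp: AE_density elim: eventually_mono)
  with A(3) have "AE x in P. False"
    by eventually_elim simp
  then show False by simp
qed

lemma leading_truncation_eqD:
  assumes eq: "leading_truncation M u R x = leading_truncation M u R y"
    and r: "r \<in> sv_index M" "r \<le> R"
  shows "u r x = u r y"
proof -
  \<comment> \<open>The list comprehension unfolds to this \<open>concat\<close>. The filtered index
    list does not depend on \<open>z\<close>, so equality of the lists becomes equality at every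
    index.\<close>
  have "concat (map (\<lambda>r. if enat r \<le> M then [u r z] else []) rs) = map (\<lambda>r. u r z) (filter (\<lambda>r. enat r \<le> M) rs)"
    for z and rs :: "nat list"
    by (induction rs) auto
  with eq have "\<forall>r\<in>set (filter (\<lambda>r. enat r \<le> M) [1..<Suc R]). u r x = u r y"
    by (simp only: leading_truncation_def map_eq_conv)
  then show ?thesis using r by (auto simp: sv_index_def)
qed

theorem theorem3:
  fixes \<pi>\<^sub>\<alpha> :: "(real^'a) measure" and \<Omega>\<^sub>\<alpha> :: "(real^'a) set"
    and \<pi>\<^sub>\<gamma> :: "(real^'c) measure" and \<Omega>\<^sub>\<gamma> :: "(real^'c) set"
    and g :: "real^'a \<Rightarrow> real^'c \<Rightarrow> real^'g"
    and D :: "real^'a \<Rightarrow> real^'c \<Rightarrow> real^'a^'g"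
    and M :: enat and \<sigma> :: "nat \<Rightarrow> real"
    and u :: "nat \<Rightarrow> real^'a \<Rightarrow> real^'g" and v :: "nat \<Rightarrow> real^'c \<Rightarrow> real"
    and \<gamma>0 :: "'p::finite \<Rightarrow> real^'c"
  assumes prob_\<alpha>: "prob_space \<pi>\<^sub>\<alpha>" and prob_\<gamma>: "prob_space \<pi>\<^sub>\<gamma>"
    and support_\<alpha>: "\<Omega>\<^sub>\<alpha> = measure_support \<pi>\<^sub>\<alpha>"
    and support_\<gamma>: "\<Omega>\<^sub>\<gamma> = measure_support \<pi>\<^sub>\<gamma>"
    and density_\<alpha>: "has_bounded_density_on \<pi>\<^sub>\<alpha> \<Omega>\<^sub>\<alpha>"
    and density_\<gamma>: "has_bounded_density_on \<pi>\<^sub>\<gamma> \<Omega>\<^sub>\<gamma>"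
    and g_measurable:
      "set_borel_measurable (\<pi>\<^sub>\<alpha> \<Otimes>\<^sub>M \<pi>\<^sub>\<gamma>) (\<Omega>\<^sub>\<alpha> \<times> \<Omega>\<^sub>\<gamma>) (\<lambda>(\<alpha>, \<gamma>). g \<alpha> \<gamma>)"
    and g_square_integrable:
      "(\<integral>\<^sup>+\<alpha>\<in>\<Omega>\<^sub>\<alpha>. (\<integral>\<^sup>+\<gamma>\<in>\<Omega>\<^sub>\<gamma>. ennreal ((norm (g \<alpha> \<gamma>))\<^sup>2) \<partial>\<pi>\<^sub>\<gamma>) \<partial>\<pi>\<^sub>\<alpha>) < \<infinity>"
    and svd: "singular_system \<pi>\<^sub>\<alpha> \<Omega>\<^sub>\<alpha> \<pi>\<^sub>\<gamma> \<Omega>\<^sub>\<gamma> g M \<sigma> u v"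
    and u_version:
      "\<And>r \<alpha>. r \<in> sv_index M \<Longrightarrow> \<alpha> \<in> \<Omega>\<^sub>\<alpha> \<Longrightarrow>
         u r \<alpha> = inverse (\<sigma> r) *\<^sub>R kernel_op \<pi>\<^sub>\<gamma> \<Omega>\<^sub>\<gamma> g (v r) \<alpha>"
    and A: "compact \<Omega>\<^sub>\<alpha>" "convex \<Omega>\<^sub>\<alpha>" "connected \<Omega>\<^sub>\<alpha>" "compact \<Omega>\<^sub>\<gamma>"
      "has_continuous_jacobian_on \<Omega>\<^sub>\<alpha> \<Omega>\<^sub>\<gamma> g D"
    and B: "\<forall>\<alpha>\<^sub>1\<in>\<Omega>\<^sub>\<alpha>. \<forall>\<alpha>\<^sub>2\<in>\<Omega>\<^sub>\<alpha>. (\<forall>\<gamma>\<in>\<Omega>\<^sub>\<gamma>. g \<alpha>\<^sub>1 \<gamma> = g \<alpha>\<^sub>2 \<gamma>) \<longrightarrow> \<alpha>\<^sub>1 = \<alpha>\<^sub>2"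
    and C: "CARD('a) \<le> CARD('g) * CARD('p)" "\<forall>i. \<gamma>0 i \<in> \<Omega>\<^sub>\<gamma>"
      "\<forall>\<alpha>\<in>\<Omega>\<^sub>\<alpha>. rank (stacked_jacobian D \<gamma>0 \<alpha>) = CARD('a)"
  shows "\<exists>R0. \<forall>R\<ge>R0. inj_on (leading_truncation M u R) \<Omega>\<^sub>\<alpha>"
proof (rule ccontr)
  assume not_inj: "\<not> ?thesis"
  obtain f where f: "f \<in> borel_measurable borel" "\<pi>\<^sub>\<alpha> = density lborel (\<lambda>x. ennreal (f x))"
    using density_\<alpha> by (auto simp: has_bounded_density_on_def)
  have sets_\<alpha>: "sets \<pi>\<^sub>\<alpha> = sets borel" and sets_\<gamma>: "sets \<pi>\<^sub>\<gamma> = sets borel"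
    using density_\<alpha> density_\<gamma> by (auto simp: has_bounded_density_on_def)
  have int: "interior \<Omega>\<^sub>\<alpha> \<noteq> {}"
  proof (rule interior_nonempty_if_density[OF prob_\<alpha> f(2) _ A(2) borel_compact[OF A(1)]])
    show "AE x in \<pi>\<^sub>\<alpha>. x \<in> \<Omega>\<^sub>\<alpha>"
      unfolding support_\<alpha> by (rule AE_in_measure_support[OF sets_\<alpha>])
  qed (use f(1) in measurable)
  obtain L where L: "0 \<le> L" "\<And>x y \<gamma>. x \<in> \<Omega>\<^sub>\<alpha> \<Longrightarrow> y \<in> \<Omega>\<^sub>\<alpha> \<Longrightarrow> \<gamma> \<in> \<Omega>\<^sub>\<gamma> \<Longrightarrow>
      norm (g x \<gamma> - g y \<gamma>) \<le> L * norm (x - y)"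
    using jacobian_lipschitz[OF A(5,2) int A(1,4)] by blast
  interpret lipschitz_kernel \<pi>\<^sub>\<alpha> \<pi>\<^sub>\<gamma> \<Omega>\<^sub>\<alpha> \<Omega>\<^sub>\<gamma> g L
    by (rule lipschitz_kernel.intro[OF prob_\<alpha> prob_\<gamma> lipschitz_kernel_axioms.intro[OF sets_\<alpha> sets_\<gamma>
          support_\<alpha> support_\<gamma> A(1,4) g_measurable g_square_integrable L]])
  let ?collision = "\<lambda>n x y. x \<in> \<Omega>\<^sub>\<alpha> \<and> y \<in> \<Omega>\<^sub>\<alpha> \<and> x \<noteq> y \<and> (\<forall>r\<in>sv_index M. r \<le> n \<longrightarrow> u r x = u r y)"
  have "\<forall>n. \<exists>x y. ?collision n x y"
  proof
    fix n
    \<comment> \<open>Failure is known only at some \<open>R\<close> beyond \<open>n\<close>;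
      agreement up to \<open>R\<close> is then restricted to indices up to \<open>n\<close>.\<close>
    obtain R where R: "n \<le> R" "\<not> inj_on (leading_truncation M u R) \<Omega>\<^sub>\<alpha>"
      using not_inj by blast
    then obtain x y where xy: "x \<in> \<Omega>\<^sub>\<alpha>" "y \<in> \<Omega>\<^sub>\<alpha>" "x \<noteq> y"
      and eq: "leading_truncation M u R x = leading_truncation M u R y"
      unfolding inj_on_def by blast
    have "\<forall>r\<in>sv_index M. r \<le> n \<longrightarrow> u r x = u r y"
      using leading_truncation_eqD[OF eq] order_trans[OF _ R(1)] by blast
    with xy show "\<exists>x y. ?collision n x y" by blast
  qed
  from choice[OF this] obtain a where "\<forall>n. \<exists>y. ?collision n (a n) y" ..
  from choice[OF this] obtain b where "\<forall>n. ?collision n (a n) (b n)" ..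
  then have ab: "\<And>n. a n \<in> \<Omega>\<^sub>\<alpha>" "\<And>n. b n \<in> \<Omega>\<^sub>\<alpha>" "\<And>n. a n \<noteq> b n"
    and u_eq: "\<And>n r. r \<in> sv_index M \<Longrightarrow> r \<le> n \<Longrightarrow> u r (a n) = u r (b n)"
    by simp_all
  obtain s q where s: "strict_mono s" and cont: "continuous_on \<Omega>\<^sub>\<gamma> q"
    and lim: "\<And>\<gamma>. \<gamma> \<in> \<Omega>\<^sub>\<gamma> \<Longrightarrow>
       (\<lambda>n. (g (a (s n)) \<gamma> - g (b (s n)) \<gamma>) /\<^sub>R norm (a (s n) - b (s n))) \<longlonglongrightarrow> q \<gamma>"
    and q: "(\<exists>x\<in>\<Omega>\<^sub>\<alpha>. \<exists>y\<in>\<Omega>\<^sub>\<alpha>. x \<noteq> y \<and> (\<forall>\<gamma>\<in>\<Omega>\<^sub>\<gamma>. q \<gamma> = (g x \<gamma> - g y \<gamma>) /\<^sub>R norm (x - y))) \<or>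
      (\<exists>x\<in>\<Omega>\<^sub>\<alpha>. \<exists>e. norm e = 1 \<and> (\<forall>\<gamma>\<in>\<Omega>\<^sub>\<gamma>. q \<gamma> = D x \<gamma> *v e))"
    using difference_quotient_limit[OF A(5,2) int A(1,4), of a b, OF ab] by blast
  have q_0: "q \<gamma> = 0" if "\<gamma> \<in> \<Omega>\<^sub>\<gamma>" for \<gamma>
    by (rule difference_quotient_limit_eq_0[where a = a and b = b, OF svd u_version ab u_eq s cont lim that])
  from q show False
  proof (elim disjE bexE exE conjE)
    \<comment> \<open>Distinct limit points: a vanishing quotient means that \<open>g\<close> does
      not separate \<open>x\<close> from \<open>y\<close>, contrary to (B).\<close>
    fix x y assume "x \<in> \<Omega>\<^sub>\<alpha>" "y \<in> \<Omega>\<^sub>\<alpha>" "x \<noteq> y" "\<forall>\<gamma>\<in>\<Omega>\<^sub>\<gamma>. q \<gamma> = (g x \<gamma> - g y \<gamma>) /\<^sub>R norm (x - y)"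
    then show False using B q_0 by auto
  next
    \<comment> \<open>Coinciding limit points: the unit vector \<open>e\<close> lies in the kernel
      of every block of the stacked Jacobian, contrary to its full column rank in (C).\<close>
    fix x e assume x: "x \<in> \<Omega>\<^sub>\<alpha>" and e: "norm e = 1" and "\<forall>\<gamma>\<in>\<Omega>\<^sub>\<gamma>. q \<gamma> = D x \<gamma> *v e"
    then have D_0: "D x (\<gamma>0 i) *v e = 0" for i using C(2) q_0 by simp
    have "(stacked_jacobian D \<gamma>0 x *v e) $ pk = (D x (\<gamma>0 (fst pk)) *v e) $ snd pk" for pk
      by (simp add: stacked_jacobian_def matrix_vector_mult_def)
    then have "stacked_jacobian D \<gamma>0 x *v e = stacked_jacobian D \<gamma>0 x *v 0"
      by (simp add: vec_eq_iff D_0)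
    moreover have "inj ((*v) (stacked_jacobian D \<gamma>0 x))"
      using C(3) x by (simp only: full_rank_injective[symmetric])
    ultimately have "e = 0" by (rule injD[rotated])
    then show False using e by simp
  qed
qed

end
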